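(* Let $\mathcal{L}$ be a lattice with least element $\bot$, let $c\colon\mathcal{L}\to\mathbb{R}_{\ge0}$ be an order-consistent nonnegative modular function, let $B\ge 0$, and let $\mathcal{F}=\{X\in\mathcal{L}: c(X)\le B\}$. Let $f\colon\mathcal{L}\to\mathbb{R}$ be a monotone function with $f(\bot)=0$ that is downward DR-submodular with additive gap $\delta$. Consider the following algorithm: start with $X=\bot$; repeatedly choose $a\in\operatorname{argmax}_{a\in\mathrm{adm}(X)}\frac{f(X\vee a)-f(X)}{c(X\vee a)-c(X)}$, and if $c(X\vee a)\le B$ set $X\leftarrow X\vee a$, otherwise stop; then choose $a^\circ\in\operatorname{argmax}_{a\in\mathrm{adm}(\bot),\,c(a)\le B}f(a)$ and return whichever of $X$ and $a^\circ$ has larger $f$-value. Then, with $X^*$ an optimal solution of $\max\{f(X):X\in\mathcal{F}\}$, the returned element $Z$ satisfies $$f(Z)\ \ge\ \frac{1-e^{-1}}{2}\,f(X^* )\;-\;\delta\, h(X^* )\,\frac{1-e^{-1}}{2}.$$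
   Context: A lattice $(\mathcal{L},\le)$ is a poset in which any two elements have a join $\vee$ (least upper bound) and meet $\wedge$ (greatest lower bound); here it has a least element $\bot$. A chain $X_1<\dots<X_k$ is a composition series if no $Y$ satisfies $X_i<Y<X_{i+1}$; $h(X)$ is the length of the longest composition series from $\bot$ to $X$. An element $a$ is join-irreducible if there are no $X\ne a$, $Y\ne a$ with $a=X\vee Y$; $J(\mathcal{L})$ is the set of these. For $X\in\mathcal{L}$, $a\in J(\mathcal{L})$ is admissible w.r.t. $X$ if $a\not\le X$ and every $a'<a$ satisfies $a'\le X$; $\mathrm{adm}(X)$ is the set of these. For $b\in\mathrm{adm}(Y)$, $\mathrm{cl}(b\mid Y)=\{b'\in\mathrm{adm}(Y): Y\vee b=Y\vee b'\}$. A function $c$ is modular if $c(X)+c(Y)=c(X\vee Y)+c(X\wedge Y)$ for all $X,Y$; it is order-consistent if $c(X\vee a)-c(X)\le c(Y\vee b)-c(Y)$ for all $X,Y\in\mathcal{L}$, $a\in\mathrm{adm}(X)$, $b\in\mathrm{adm}(Y)$ with $a\le b$. $f$ is monotone if $X\le Y\Rightarrow f(X)\le f(Y)$. $f$ is downward DR-submodular with additive gap $\delta$ if for all $X\le Y$ and $b\in\mathrm{adm}(Y)$, $$f(Y\vee b)-f(Y)\le\max_{b'\in\mathrm{cl}(b\mid Y)}\ \min_{a\in\mathrm{adm}(X),\,a\le b'}\bigl(f(X\vee a)-f(X)\bigr)+\delta.$$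
   Formalization: The statement is false as given; the formal version also assumes c(⊥) ≤ c(a) ≤ B for every a in adm(⊥) and that chains below each element have bounded length (h finite); density with zero cost is ∞ for positive gain and 0 for zero gain. *)

theory Defs
  imports Complex_Main "HOL-Library.Extended_Real"
begin

definition composition_series :: "'a::lattice list \<Rightarrow> bool" where
  "composition_series Xs \<longleftrightarrow>
     Xs \<noteq> [] \<and> successively (\<lambda>X X'. X < X' \<and> \<not> (\<exists>Y. X < Y \<and> Y < X')) Xs"

text \<open>The length of \<open>X\<^sub>1 < \<dots> < X\<^sub>k\<close> is the number \<open>k - 1\<close> of steps, so that
  \<open>\<bottom>\<close> has height \<open>0\<close> and a \<open>d\<close>-dimensional subspace has height \<open>d\<close>.\<close>

definition height :: "'a::bounded_lattice_bot \<Rightarrow> nat" where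
  "height X =
     Max {length Xs - 1 | Xs. composition_series Xs \<and> hd Xs = bot \<and> last Xs = X}"

text \<open>Boundedness of the chains below \<open>X\<close>. This makes the maximum in \<open>height\<close> one over a
  finite nonempty set; the lattice itself may be infinite and need not have a top element.\<close>

definition finite_height :: "'a::bounded_lattice_bot \<Rightarrow> bool" where
  "finite_height X \<longleftrightarrow>
     (\<exists>n. \<forall>Xs. sorted_wrt (<) Xs \<and> set Xs \<subseteq> {..X} \<longrightarrow> length Xs \<le> n)"

text \<open>By this definition \<open>\<bottom>\<close> is join-irreducible, but it is never admissible.\<close>

definition join_irreducible :: "'a::lattice \<Rightarrow> bool" where
  "join_irreducible a \<longleftrightarrow> \<not> (\<exists>X Y. X \<noteq> a \<and> Y \<noteq> a \<and> a = sup X Y)"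

definition adm :: "'a::lattice \<Rightarrow> 'a set" where
  "adm X = {a. join_irreducible a \<and> \<not> a \<le> X \<and> (\<forall>a'. a' < a \<longrightarrow> a' \<le> X)}"

definition cl :: "'a::lattice \<Rightarrow> 'a \<Rightarrow> 'a set" where
  "cl b Y = {b' \<in> adm Y. sup Y b = sup Y b'}"

definition modular_fun :: "('a::lattice \<Rightarrow> real) \<Rightarrow> bool" where
  "modular_fun c \<longleftrightarrow> (\<forall>X Y. c X + c Y = c (sup X Y) + c (inf X Y))"

definition order_consistent :: "('a::lattice \<Rightarrow> real) \<Rightarrow> bool" where
  "order_consistent c \<longleftrightarrow>
     (\<forall>X Y. \<forall>a\<in>adm X. \<forall>b\<in>adm Y. a \<le> b \<longrightarrow> c (sup X a) - c X \<le> c (sup Y b) - c Y)"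

text \<open>The index sets may be infinite, so the maximum and the minimum are taken as supremum and
  infimum in the extended reals; they agree with maximum and minimum whenever these exist.\<close>

definition downward_DR_submodular :: "('a::lattice \<Rightarrow> real) \<Rightarrow> real \<Rightarrow> bool" where
  "downward_DR_submodular f \<delta> \<longleftrightarrow>
     (\<forall>X Y. \<forall>b\<in>adm Y. X \<le> Y \<longrightarrow>
        ereal (f (sup Y b) - f Y)
          \<le> (SUP b'\<in>cl b Y. INF a\<in>{a \<in> adm X. a \<le> b'}. ereal (f (sup X a) - f X)) + ereal \<delta>)"

text \<open>Division is that of the extended reals: a positive gain at zero cost has density \<open>\<infinity>\<close>,
  and \<open>0 / 0 = 0\<close>.\<close>

definition density :: "('a::lattice \<Rightarrow> real) \<Rightarrow> ('a \<Rightarrow> real) \<Rightarrow> 'a \<Rightarrow> 'a \<Rightarrow> ereal" where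
  "density f c X a = ereal (f (sup X a) - f X) / ereal (c (sup X a) - c X)"

definition greedy_choice :: "('a::lattice \<Rightarrow> real) \<Rightarrow> ('a \<Rightarrow> real) \<Rightarrow> 'a \<Rightarrow> 'a \<Rightarrow> bool" where
  "greedy_choice f c X a \<longleftrightarrow> is_arg_max (density f c X) (\<lambda>a. a \<in> adm X) a"

inductive greedy_reachable ::
    "('a::bounded_lattice_bot \<Rightarrow> real) \<Rightarrow> ('a \<Rightarrow> real) \<Rightarrow> real \<Rightarrow> 'a \<Rightarrow> bool"
  for f c B where
  start: "greedy_reachable f c B bot"
| step: "greedy_reachable f c B X \<Longrightarrow> greedy_choice f c X a \<Longrightarrow> c (sup X a) \<le> B
           \<Longrightarrow> greedy_reachable f c B (sup X a)"

text \<open>The loop also ends when there is no admissible element left to choose from.\<close>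

definition greedy_result ::
    "('a::bounded_lattice_bot \<Rightarrow> real) \<Rightarrow> ('a \<Rightarrow> real) \<Rightarrow> real \<Rightarrow> 'a \<Rightarrow> bool" where
  "greedy_result f c B X \<longleftrightarrow>
     greedy_reachable f c B X \<and>
     (adm X = {} \<or> (\<exists>a. greedy_choice f c X a \<and> \<not> c (sup X a) \<le> B))"

text \<open>Ties are broken arbitrarily, so the output is a relation. If no admissible element of \<open>\<bottom>\<close>
  is within the budget, there is no second candidate and the greedy result is returned.\<close>

definition knapsack_greedy_returns ::
    "('a::bounded_lattice_bot \<Rightarrow> real) \<Rightarrow> ('a \<Rightarrow> real) \<Rightarrow> real \<Rightarrow> 'a \<Rightarrow> bool" where
  "knapsack_greedy_returns f c B Z \<longleftrightarrow>
     (\<exists>X. greedy_result f c B X \<and>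
        ({a \<in> adm bot. c a \<le> B} = {} \<and> Z = X \<or>
         (\<exists>a. is_arg_max f (\<lambda>a. a \<in> adm bot \<and> c a \<le> B) a \<and>
              (Z = X \<and> f a \<le> f X \<or> Z = a \<and> f X \<le> f a))))"

end

theory Submission
  imports Defs
begin

text \<open>
  Write \<open>D = f X\<^sup>* - \<delta> (h X\<^sup>* - 1)\<close> and \<open>B' = B - c \<bottom>\<close>. Climb from a greedy iterate \<open>X\<close> to
  \<open>X \<squnion> X\<^sup>*\<close> by admissible elements below \<open>X\<^sup>*\<close>. Each of the at most \<open>h X\<^sup>*\<close> steps gains at most
  the greedy density times its cost, plus \<open>\<delta>\<close>, and the very first step needs no \<open>\<delta>\<close>. By modularity
  the total cost is at most \<open>B'\<close>, so a greedy step of gain \<open>g\<close> and cost \<open>k\<close> satisfies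
  \<open>(D - f X) k \<le> g B'\<close>. Adding this up over all steps, including the final one that overshoots the
  budget and whose gain is at most \<open>f a\<^sup>\<circ> + \<delta>\<close>, gives \<open>D - f X \<le> f X + f a\<^sup>\<circ> + \<delta>\<close> for the greedy
  result \<open>X\<close>. Hence \<open>f X\<^sup>* - \<delta> h X\<^sup>* \<le> 3 max (f X) (f a\<^sup>\<circ>)\<close>, and \<open>(1 - 1/e) / 2 \<le> 1/3\<close>. The
  \<open>\<delta>\<close> saved in the first step pays for the one lost in the overshooting step.
\<close>

section \<open>Longest chains, admissible elements and height\<close>

lemma longest_chain_exists:
  fixes X :: "'a::bounded_lattice_bot"
  assumes "finite_height X" and "P Xs"
    and "\<And>Xs. P Xs \<Longrightarrow> sorted_wrt (<) Xs \<and> set Xs \<subseteq> {..X}"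
  obtains Ys where "P Ys" and "\<And>Zs. P Zs \<Longrightarrow> length Zs \<le> length Ys"
proof -
  obtain n where "\<forall>Xs. sorted_wrt (<) Xs \<and> set Xs \<subseteq> {..X} \<longrightarrow> length Xs \<le> n"
    using assms(1) unfolding finite_height_def by auto
  then have "\<forall>Xs. P Xs \<longrightarrow> length Xs < Suc n" using assms(3) by (simp add: less_Suc_eq_le)
  with assms(2) have "\<exists>Ys. P Ys \<and> (\<forall>Zs. P Zs \<longrightarrow> length Zs \<le> length Ys)"
    by (rule ex_has_greatest_nat)
  then show thesis using that by blast
qed

text \<open>The bottom \<open>b\<close> of a longest chain of elements below \<open>Z\<close> but
  not below \<open>W\<close> is minimal among them, since a smaller one could be prepended.
  Minimality gives join-irreducibility: two proper parts of \<open>b\<close> would lie below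
  \<open>W\<close>, and so would their join.\<close>

lemma admissible_below:
  fixes W Z :: "'a::bounded_lattice_bot"
  assumes "finite_height Z" and "\<not> Z \<le> W"
  obtains b where "b \<in> adm W" and "b \<le> Z"
proof -
  define P where "P = (\<lambda>Xs. sorted_wrt (<) Xs \<and> set Xs \<subseteq> {..Z} \<and> (\<forall>x\<in>set Xs. \<not> x \<le> W))"
  have "P [Z]" using assms(2) by (simp add: P_def)
  then obtain Ys where Ys: "P Ys" and longest: "\<And>Zs. P Zs \<Longrightarrow> length Zs \<le> length Ys"
    using longest_chain_exists[OF assms(1), of P "[Z]"] unfolding P_def by blast
  from longest[OF \<open>P [Z]\<close>] obtain b bs where b: "Ys = b # bs" by (cases Ys) auto
  have bZ: "b \<le> Z" and bW: "\<not> b \<le> W" using Ys b by (auto simp: P_def)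
  have below: "x \<le> W" if "x < b" for x
  proof (rule ccontr)
    assume "\<not> x \<le> W"
    then have "P (x # Ys)" using Ys b that bZ by (auto simp: P_def)
    then show False using longest by fastforce
  qed
  have "join_irreducible b"
    unfolding join_irreducible_def
  proof (rule notI, elim exE conjE)
    fix x y assume "x \<noteq> b" "y \<noteq> b" "b = sup x y"
    then have "x < b" "y < b" by (metis order_le_less sup_ge1, metis order_le_less sup_ge2)
    then have "sup x y \<le> W" using below by simp
    then show False using bW \<open>b = sup x y\<close> by simp
  qed
  then have "b \<in> adm W" using below bW by (simp add: adm_def)
  then show thesis using that bZ by blast
qed

text \<open>Keeps the inner minimum in \<open>downward_DR_submodular\<close> from ranging over an
  empty set, and supplies elements to compare by order-consistency.\<close>

lemma adm_mono_below:
  fixes X Y :: "'a::bounded_lattice_bot"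
  assumes "finite_height b" and "X \<le> Y" and "b \<in> adm Y"
  obtains a where "a \<in> adm X" and "a \<le> b"
proof -
  have "\<not> b \<le> X" using assms(2,3) by (auto simp: adm_def)
  then show thesis using admissible_below[OF assms(1)] that by blast
qed

text \<open>\<open>height\<close> counts composition series only, but a longest chain below
  \<open>X\<close> is one from \<open>bot\<close> to \<open>X\<close>: otherwise it could be
  extended at an end or refined in between.\<close>

lemma chain_length_le_height:
  fixes X :: "'a::bounded_lattice_bot"
  assumes "finite_height X" and "sorted_wrt (<) Xs" and "set Xs \<subseteq> {..X}"
  shows "length Xs - 1 \<le> height X"
proof -
  define P where "P = (\<lambda>Xs. sorted_wrt (<) Xs \<and> set Xs \<subseteq> {..X})"
  have "P Xs" using assms by (simp add: P_def)
  then obtain Ys where Ys: "P Ys" and longest: "\<And>Zs. P Zs \<Longrightarrow> length Zs \<le> length Ys"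
    using longest_chain_exists[OF assms(1), of P Xs] unfolding P_def by blast
  have "P [X]" by (simp add: P_def)
  then have ne: "Ys \<noteq> []" using longest by fastforce
  have sorted: "sorted_wrt (<) Ys" and below: "set Ys \<subseteq> {..X}" using Ys by (auto simp: P_def)
  have "hd Ys = bot"
  proof (rule ccontr)
    assume "hd Ys \<noteq> bot"
    then have "bot < hd Ys" by (simp add: bot.not_eq_extremum)
    then have "P (bot # Ys)" using sorted below ne
      by (cases Ys) (auto simp: P_def dest: less_trans)
    then show False using longest by fastforce
  qed
  moreover have "last Ys = X"
  proof (rule ccontr)
    assume "last Ys \<noteq> X"
    then have lt: "last Ys < X" using below last_in_set[OF ne] by (auto simp: order_less_le)
    have split: "Ys = butlast Ys @ [last Ys]" using ne by simp
    have "y < X" if "y \<in> set Ys" for y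
    proof -
      have "y \<in> set (butlast Ys) \<or> y = last Ys"
        using that split by (metis Un_iff empty_iff empty_set list.set(2) insert_iff set_append)
      moreover have "\<forall>y\<in>set (butlast Ys). y < last Ys"
        using sorted sorted_wrt_append[of "(<)" "butlast Ys" "[last Ys]"] split by simp
      ultimately show ?thesis using lt less_trans by blast
    qed
    then have "P (Ys @ [X])" using sorted below by (auto simp: P_def sorted_wrt_append)
    then show False using longest by fastforce
  qed
  moreover have "composition_series Ys"
    unfolding composition_series_def
  proof (intro conjI ne, unfold successively_conv_nth, intro allI impI)
    fix i assume i: "Suc i < length Ys"
    define as bs where "as = take i Ys" and "bs = drop (Suc (Suc i)) Ys"
    have split: "Ys = as @ Ys ! i # Ys ! Suc i # bs"
      unfolding as_def bs_def using i by (simp add: Cons_nth_drop_Suc)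
    have lt: "Ys ! i < Ys ! Suc i" using sorted i by (simp add: sorted_wrt_nth_less)
    have False if z: "Ys ! i < z" "z < Ys ! Suc i" for z
    proof -
      have "sorted_wrt (<) (as @ Ys ! i # Ys ! Suc i # bs)"
        "set (as @ Ys ! i # Ys ! Suc i # bs) \<subseteq> {..X}"
        using sorted below split by simp_all
      then have "P (as @ Ys ! i # z # Ys ! Suc i # bs)"
        using z by (auto simp: P_def sorted_wrt_append dest: less_trans less_imp_le)
      then have "length (as @ Ys ! i # z # Ys ! Suc i # bs) \<le> length Ys" by (rule longest)
      also have "length Ys = length (as @ Ys ! i # Ys ! Suc i # bs)"
        using split by simp
      finally show False by simp
    qed
    with lt show "Ys ! i < Ys ! Suc i \<and> \<not> (\<exists>Y. Ys ! i < Y \<and> Y < Ys ! Suc i)" by blast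
  qed
  ultimately have mem: "length Ys - 1 \<in>
      {length Xs - 1 | Xs. composition_series Xs \<and> hd Xs = bot \<and> last Xs = X}"
    (is "_ \<in> ?S") by blast
  \<comment> \<open>\<open>Max_ge\<close> needs a finite set: the series counted are chains below
    \<open>X\<close>, hence no longer than \<open>Ys\<close>.\<close>
  have "?S \<subseteq> {..length Ys}"
  proof clarsimp
    fix Zs :: "'a list" assume Zs: "composition_series Zs" "X = last Zs"
    then have "successively (<) Zs"
      unfolding composition_series_def by (auto elim: successively_mono)
    then have "sorted_wrt (<) Zs" by (simp add: successively_conv_sorted_wrt)
    moreover from this have "set Zs \<subseteq> {..last Zs}"
    proof (induction Zs rule: rev_induct)
      case (snoc z Zs)
      then show ?case by (auto simp: sorted_wrt_append)
    qed simp
    ultimately have "P Zs" using Zs by (simp add: P_def)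
    then show "length Zs - Suc 0 \<le> length Ys" using longest by fastforce
  qed
  then have "finite ?S" by (rule finite_subset) simp
  then have "length Ys - 1 \<le> height X" unfolding height_def using mem by (rule Max_ge)
  then show ?thesis using longest[OF \<open>P Xs\<close>] by linarith
qed

lemma height_bot: "height (bot::'a::bounded_lattice_bot) = 0"
proof -
  have "length Xs = 1" if "composition_series Xs" "hd Xs = bot" "last Xs = bot" for Xs :: "'a list"
  proof (cases Xs rule: rev_cases)
    case Nil
    then show ?thesis using that(1) by (simp add: composition_series_def)
  next
    case (snoc Ys y)
    show ?thesis
    proof (cases Ys rule: rev_cases)
      case Nil
      then show ?thesis using snoc by simp
    next
      case (snoc Zs z)
      then have "z < y" using that(1) \<open>Xs = Ys @ [y]\<close>
        by (simp add: composition_series_def successively_append_iff)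
      then show ?thesis using that(3) \<open>Xs = Ys @ [y]\<close> by simp
    qed
  qed
  moreover have "composition_series [bot::'a]" by (simp add: composition_series_def)
  ultimately have "{length Xs - 1 | Xs. composition_series Xs \<and> hd Xs = bot \<and> last Xs = (bot::'a)}
      = {0}" by (auto intro!: exI[of _ "[bot]"])
  then show ?thesis by (simp add: height_def)
qed

lemma height_pos:
  fixes X :: "'a::bounded_lattice_bot"
  assumes "finite_height X" and "X \<noteq> bot"
  shows "1 \<le> height X"
  using chain_length_le_height[of X "[bot, X]"] assms by (simp add: bot.not_eq_extremum)

section \<open>Climbing by admissible elements\<close>

text \<open>The factor \<open>height Z - 1\<close> in place of \<open>height Z\<close> comes from the first step, which starts at
  \<open>X\<close> itself.\<close>

lemma increment_bound_along_chain:
  fixes \<phi> :: "'a::bounded_lattice_bot \<Rightarrow> real"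
  assumes fin: "finite_height Z"
    and first: "\<And>b. b \<in> adm X \<Longrightarrow> \<phi> (sup X b) \<le> \<phi> X"
    and later: "\<And>W b. X \<le> W \<Longrightarrow> b \<in> adm W \<Longrightarrow> \<phi> (sup W b) \<le> \<phi> W + \<epsilon>"
    and \<epsilon>: "0 \<le> \<epsilon>"
  shows "\<phi> (sup X Z) \<le> \<phi> X + \<epsilon> * real (height Z - 1)"
proof -
  \<comment> \<open>The chain records the joins of the elements used so far and stays below
    \<open>Z\<close>, so \<open>height Z\<close> limits its length. With \<open>n\<close> elements
    it has \<open>n - 1\<close> steps, the first without loss, whence \<open>length Ys - 2\<close>,
    truncated to 0 for \<open>[bot]\<close>.\<close>
  define P where "P = (\<lambda>Ys. sorted_wrt (<) Ys \<and> set Ys \<subseteq> {..Z} \<and> Ys \<noteq> [] \<and> hd Ys = bot \<and>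
    (\<forall>y\<in>set Ys. y \<le> last Ys) \<and>
    \<phi> (sup X (last Ys)) \<le> \<phi> X + \<epsilon> * real (length Ys - 2))"
  have "P [bot]" by (simp add: P_def)
  then obtain Ys where Ys: "P Ys" and longest: "\<And>Zs. P Zs \<Longrightarrow> length Zs \<le> length Ys"
    using longest_chain_exists[OF fin, of P "[bot]"] unfolding P_def by blast
  define Y where "Y = last Ys"
  have sorted: "sorted_wrt (<) Ys" and below: "set Ys \<subseteq> {..Z}" and ne: "Ys \<noteq> []"
    and hd: "hd Ys = bot" and top: "\<And>y. y \<in> set Ys \<Longrightarrow> y \<le> Y"
    and bound: "\<phi> (sup X Y) \<le> \<phi> X + \<epsilon> * real (length Ys - 2)"
    using Ys by (auto simp: P_def Y_def)
  have YZ: "Y \<le> Z" using below last_in_set[OF ne] by (auto simp: Y_def)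
  have "Z \<le> sup X Y"
  proof (rule ccontr)
    assume "\<not> Z \<le> sup X Y"
    then obtain b where b: "b \<in> adm (sup X Y)" "b \<le> Z"
      using admissible_below[OF fin] by blast
    have lt: "Y < sup Y b"
    proof -
      have "\<not> b \<le> Y" using b(1) by (auto simp: adm_def intro: le_supI2)
      then show ?thesis by (simp add: less_le_not_le)
    qed
    have "\<phi> (sup X (sup Y b)) \<le> \<phi> X + \<epsilon> * real (length Ys - 1)"
    \<comment> \<open>In this case the climb is still at \<open>X\<close>, where
      \<open>first\<close> applies.\<close>
    proof (cases "length Ys = 1")
      case True
      then have "Y = bot" using hd by (cases Ys) (auto simp: Y_def)
      then show ?thesis using first b(1) True by simp
    next
      case False
      with ne have len: "real (length Ys - 1) = real (length Ys - 2) + 1"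
        by (cases Ys) (auto simp: neq_Nil_conv)
      have "\<phi> (sup X (sup Y b)) \<le> \<phi> (sup X Y) + \<epsilon>"
        using later[OF _ b(1)] by (simp add: sup_assoc)
      then show ?thesis using bound unfolding len by (simp add: algebra_simps)
    qed
    then have "P (Ys @ [sup Y b])"
      using sorted below ne hd top YZ b(2) lt
      by (auto simp: P_def sorted_wrt_append intro: le_less_trans le_supI1)
    then show False using longest by fastforce
  qed
  then have "sup X Z = sup X Y"
    using YZ by (meson antisym le_supI sup.cobounded1 sup_mono order_refl)
  moreover have "length Ys - 2 \<le> height Z - 1"
    using chain_length_le_height[OF fin sorted below] by linarith
  then have "\<epsilon> * real (length Ys - 2) \<le> \<epsilon> * real (height Z - 1)"
    using \<epsilon> by (intro mult_left_mono) simp_all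
  ultimately show ?thesis using bound by simp
qed

section \<open>Consequences of DR-submodularity and of the greedy rule\<close>

lemma DR_gain_le:
  fixes f :: "'a::bounded_lattice_bot \<Rightarrow> real"
  assumes fin: "\<And>X::'a. finite_height X"
    and DR: "downward_DR_submodular f \<delta>" and le: "X \<le> Y" and b: "b \<in> adm Y"
    and bound: "\<And>b' a. b' \<in> cl b Y \<Longrightarrow> a \<in> adm X \<Longrightarrow> a \<le> b' \<Longrightarrow> f (sup X a) - f X \<le> r"
  shows "f (sup Y b) - f Y \<le> r + \<delta>"
proof -
  have "(INF a\<in>{a \<in> adm X. a \<le> b'}. ereal (f (sup X a) - f X)) \<le> ereal r"
    if b': "b' \<in> cl b Y" for b'
  proof -
    from b' have "b' \<in> adm Y" by (simp add: cl_def)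
    then obtain a where "a \<in> adm X" "a \<le> b'" using adm_mono_below[OF fin le] by blast
    then show ?thesis using bound[OF b'] by (intro INF_lower2[of a]) auto
  qed
  then have "(SUP b'\<in>cl b Y. INF a\<in>{a \<in> adm X. a \<le> b'}. ereal (f (sup X a) - f X)) \<le> ereal r"
    by (rule SUP_least)
  moreover have "ereal (f (sup Y b) - f Y)
      \<le> (SUP b'\<in>cl b Y. INF a\<in>{a \<in> adm X. a \<le> b'}. ereal (f (sup X a) - f X)) + ereal \<delta>"
    using DR le b unfolding downward_DR_submodular_def by blast
  ultimately have "ereal (f (sup Y b) - f Y) \<le> ereal r + ereal \<delta>"
    by (meson add_right_mono order_trans)
  then show ?thesis by simp
qed

text \<open>For \<open>X = Y\<close> the only admissible element below \<open>b'\<close> is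
  \<open>b'\<close> itself, as all smaller elements lie below \<open>Y\<close>; and all members of
  \<open>cl b Y\<close> have the gain of \<open>b\<close>. So the condition compares this gain with
  itself plus \<delta>.\<close>

lemma DR_gap_nonneg:
  fixes f :: "'a::bounded_lattice_bot \<Rightarrow> real"
  assumes fin: "\<And>X::'a. finite_height X"
    and DR: "downward_DR_submodular f \<delta>" and b: "b \<in> adm (Y::'a)"
  shows "0 \<le> \<delta>"
proof -
  have "f (sup Y b) - f Y \<le> (f (sup Y b) - f Y) + \<delta>"
  proof (rule DR_gain_le[OF fin DR order_refl b])
    fix b' a assume "b' \<in> cl b Y" "a \<in> adm Y" "a \<le> b'"
    then have "a = b'" by (auto simp: cl_def adm_def order_less_le)
    then show "f (sup Y a) - f Y \<le> f (sup Y b) - f Y"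
      using \<open>b' \<in> cl b Y\<close> by (simp add: cl_def)
  qed
  then show ?thesis by simp
qed

lemma greedy_choice_density:
  fixes f c :: "'a::bounded_lattice_bot \<Rightarrow> real"
  assumes greedy: "greedy_choice f c X a" and pos: "c X < c (sup X a)"
    and b: "b \<in> adm X" and "f X \<le> f (sup X b)" and "c X \<le> c (sup X b)"
  shows "(c (sup X a) - c X) * (f (sup X b) - f X) \<le> (f (sup X a) - f X) * (c (sup X b) - c X)"
proof -
  have le: "density f c X b \<le> density f c X a"
    using greedy b unfolding greedy_choice_def is_arg_max_def by force
  show ?thesis
  \<comment> \<open>A zero-cost \<open>b\<close> with positive gain would have infinite density and
    beat the finite density of \<open>a\<close>.\<close>
  proof (cases "c X = c (sup X b)")
    case True
    have "f (sup X b) = f X"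
    proof (rule ccontr)
      assume "f (sup X b) \<noteq> f X"
      then have "density f c X b = \<infinity>" using assms(4) True by (simp add: density_def divide_ereal_def)
      then show False using le pos by (simp add: density_def)
    qed
    then show ?thesis using True by simp
  next
    case False
    then have "c X < c (sup X b)" using assms(5) by simp
    then show ?thesis using le pos by (simp add: density_def field_simps)
  qed
qed

section \<open>Cost and value along the greedy run\<close>

locale greedy_knapsack =
  fixes c f :: "'a::bounded_lattice_bot \<Rightarrow> real" and B \<delta> :: real and Xopt :: 'a
  assumes fin: "\<And>X::'a. finite_height X"
    and c_modular: "modular_fun c"
    and c_consistent: "order_consistent c"
    and c_increment: "\<And>a. a \<in> adm bot \<Longrightarrow> c bot \<le> c a"
    and f_mono: "mono f"
    and f_bot: "f bot = 0"
    and f_DR: "downward_DR_submodular f \<delta>"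
    and Xopt_fits: "c Xopt \<le> B"
begin

text \<open>Order-consistency carries the sign of the increments at \<open>bot\<close> to every
  \<open>X\<close>.\<close>

lemma c_adm_le: "c X \<le> c (sup X a)" if a: "a \<in> adm X"
proof -
  obtain a' where a': "a' \<in> adm bot" "a' \<le> a"
    using adm_mono_below[OF fin bot_least a] by blast
  then have "c (sup bot a') - c bot \<le> c (sup X a) - c X"
    using c_consistent a unfolding order_consistent_def by blast
  then show ?thesis using c_increment[OF a'(1)] by simp
qed

text \<open>Climbing from \<open>X\<close> to \<open>Y\<close> with potential \<open>- c\<close> and
  no loss per step.\<close>

lemma c_mono: "X \<le> Y \<Longrightarrow> c X \<le> c Y"
  using increment_bound_along_chain[OF fin, of X "\<lambda>X. - c X" 0 Y] c_adm_le
  by (auto simp: sup_absorb2)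

lemma f_nonneg: "0 \<le> f X"
  using monoD[OF f_mono bot_least[of X]] f_bot by simp

lemma greedy_step_bound:
  assumes greedy: "greedy_choice f c X a"
  shows "(f Xopt - \<delta> * real (height Xopt - 1) - f X) * (c (sup X a) - c X)
    \<le> (f (sup X a) - f X) * (B - c bot)"
proof (cases "c X < c (sup X a)")
  case False
  have a: "a \<in> adm X" using greedy by (simp add: greedy_choice_def is_arg_max_def)
  have "0 \<le> (f (sup X a) - f X) * (B - c bot)"
    using monoD[OF f_mono, of X "sup X a"] c_mono[OF bot_least, of Xopt] Xopt_fits
    by (intro mult_nonneg_nonneg) auto
  then show ?thesis using False c_adm_le[OF a] by simp
next
  case True
  define g k where "g = f (sup X a) - f X" and "k = c (sup X a) - c X"
  have a: "a \<in> adm X" using greedy by (simp add: greedy_choice_def is_arg_max_def)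
  have k: "0 < k" using True by (simp add: k_def)
  have g: "0 \<le> g" using monoD[OF f_mono, of X "sup X a"] by (simp add: g_def)
  have dens: "k * (f (sup X b) - f X) \<le> g * (c (sup X b) - c X)" if "b \<in> adm X" for b
    unfolding g_def k_def
    using greedy_choice_density[OF greedy True that] monoD[OF f_mono, of X "sup X b"]
      c_adm_le[OF that] by simp
  \<comment> \<open>The potential encodes the greedy density \<open>g / k\<close> without division:
    the greedy rule keeps it from growing in a step from \<open>X\<close>, and DR-submodularity
    limits later growth to \<open>k * \<delta>\<close>.\<close>
  define \<phi> where "\<phi> = (\<lambda>W. k * f W - g * c W)"
  have "\<phi> (sup X Xopt) \<le> \<phi> X + k * \<delta> * real (height Xopt - 1)"
  proof (rule increment_bound_along_chain[OF fin])
    show "\<phi> (sup X b) \<le> \<phi> X" if "b \<in> adm X" for b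
      using dens[OF that] by (simp add: \<phi>_def algebra_simps)
    show "0 \<le> k * \<delta>" using DR_gap_nonneg[OF fin f_DR a] k by simp
    fix W b assume W: "X \<le> W" and b: "b \<in> adm W"
    \<comment> \<open>The cost of \<open>a'\<close> at \<open>X\<close> is at most that of
      \<open>b'\<close> at \<open>W\<close> by order-consistency, and \<open>b'\<close> costs as
      much as \<open>b\<close> because their joins with \<open>W\<close> agree.\<close>
    have "f (sup W b) - f W \<le> g * (c (sup W b) - c W) / k + \<delta>"
    proof (rule DR_gain_le[OF fin f_DR W b])
      fix b' a' assume b': "b' \<in> cl b W" and a': "a' \<in> adm X" "a' \<le> b'"
      have "c (sup X a') - c X \<le> c (sup W b') - c W"
        using c_consistent a' b' unfolding order_consistent_def cl_def by blast
      also have "\<dots> = c (sup W b) - c W" using b' by (simp add: cl_def)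
      finally have "g * (c (sup X a') - c X) \<le> g * (c (sup W b) - c W)"
        using g by (rule mult_left_mono)
      then have "k * (f (sup X a') - f X) \<le> g * (c (sup W b) - c W)"
        using dens[OF a'(1)] by linarith
      then show "f (sup X a') - f X \<le> g * (c (sup W b) - c W) / k"
        using k by (simp add: pos_le_divide_eq mult.commute)
    qed
    then have "k * (f (sup W b) - f W) \<le> k * (g * (c (sup W b) - c W) / k + \<delta>)"
      using k by (intro mult_left_mono) simp_all
    then have "k * (f (sup W b) - f W) \<le> g * (c (sup W b) - c W) + k * \<delta>"
      using k by (simp add: distrib_left)
    then show "\<phi> (sup W b) \<le> \<phi> W + k * \<delta>" by (simp add: \<phi>_def algebra_simps)
  qed
  then have "k * (f (sup X Xopt) - f X) \<le>
      g * (c (sup X Xopt) - c X) + k * \<delta> * real (height Xopt - 1)"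
    by (simp add: \<phi>_def algebra_simps)
  moreover have "c (sup X Xopt) - c X \<le> B - c bot"
  proof -
    have "c X + c Xopt = c (sup X Xopt) + c (inf X Xopt)"
      using c_modular by (simp add: modular_fun_def)
    then show ?thesis using c_mono[OF bot_least, of "inf X Xopt"] Xopt_fits by linarith
  qed
  then have "g * (c (sup X Xopt) - c X) \<le> g * (B - c bot)" using g by (rule mult_left_mono)
  moreover have "k * (f Xopt - f X) \<le> k * (f (sup X Xopt) - f X)"
    using k monoD[OF f_mono, of Xopt "sup X Xopt"] by (intro mult_left_mono) simp_all
  ultimately have "k * (f Xopt - f X) \<le> g * (B - c bot) + k * \<delta> * real (height Xopt - 1)"
    by linarith
  then show ?thesis unfolding g_def[symmetric] k_def[symmetric] by (simp add: algebra_simps)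
qed

text \<open>Sums \<open>greedy_step_bound\<close> over the run; by monotonicity of \<open>f\<close>,
  the factor on the left only shrinks as the iterate grows.\<close>

lemma greedy_reachable_bound:
  assumes "greedy_reachable f c B X"
  shows "(f Xopt - \<delta> * real (height Xopt - 1) - f X) * (c X - c bot) \<le> f X * (B - c bot)"
  using assms
proof induction
  case start
  then show ?case by (simp add: f_bot)
next
  case (step X a)
  let ?D = "f Xopt - \<delta> * real (height Xopt - 1)"
  have "(?D - f (sup X a)) * (c (sup X a) - c bot) \<le> (?D - f X) * (c (sup X a) - c bot)"
    using monoD[OF f_mono, of X "sup X a"] c_mono[OF bot_least, of "sup X a"]
    by (intro mult_right_mono) auto
  then show ?case using step.IH greedy_step_bound[OF step.hyps(2)] by (simp add: algebra_simps)
qed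

text \<open>DR-submodularity between \<open>bot\<close> and \<open>X\<close>; as
  \<open>f bot = 0\<close>, gains at \<open>bot\<close> are values of single admissible
  elements.\<close>

lemma overshooting_gain_le:
  assumes a: "a \<in> adm X" and s: "\<And>b. b \<in> adm bot \<Longrightarrow> f b \<le> s"
  shows "f (sup X a) - f X \<le> s + \<delta>"
  using DR_gain_le[OF fin f_DR bot_least a] s f_bot by simp

lemma greedy_overshoot_bound:
  assumes X: "greedy_reachable f c B X" and greedy: "greedy_choice f c X a"
    and over: "\<not> c (sup X a) \<le> B" and s: "\<And>b. b \<in> adm bot \<Longrightarrow> f b \<le> s"
    and h: "1 \<le> height Xopt"
  shows "f Xopt - \<delta> * real (height Xopt) \<le> 2 * f X + s \<or>
    f Xopt - \<delta> * real (height Xopt) \<le> f X"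
proof -
  define D where "D = f Xopt - \<delta> * real (height Xopt - 1)"
  have a: "a \<in> adm X" using greedy by (simp add: greedy_choice_def is_arg_max_def)
  have \<delta>: "0 \<le> \<delta>" by (rule DR_gap_nonneg[OF fin f_DR a])
  have D: "f Xopt - \<delta> * real (height Xopt) = D - \<delta>"
    using h by (simp add: D_def algebra_simps)
  have B': "0 \<le> B - c bot" using c_mono[OF bot_least, of Xopt] Xopt_fits by simp
  have "(D - f X) * (c (sup X a) - c bot) \<le> f (sup X a) * (B - c bot)"
    using greedy_reachable_bound[OF X] greedy_step_bound[OF greedy]
    by (simp add: D_def algebra_simps)
  also have "\<dots> \<le> (f X + s + \<delta>) * (B - c bot)"
    using overshooting_gain_le[OF a s] B' by (intro mult_right_mono) simp_all
  finally have sum: "(D - f X) * (c (sup X a) - c bot) \<le> (f X + s + \<delta>) * (B - c bot)" .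
  show ?thesis
  proof (cases "D \<le> f X")
    case True
    then show ?thesis using D \<delta> by simp
  next
    case False
    \<comment> \<open>Overshooting means that the cost spent exceeds \<open>B - c bot\<close>, so
      this factor can replace it and then be cancelled.\<close>
    have "(D - f X) * (B - c bot) < (D - f X) * (c (sup X a) - c bot)"
      using False over by (intro mult_strict_left_mono) simp_all
    then have "(D - f X) * (B - c bot) < (f X + s + \<delta>) * (B - c bot)" using sum by linarith
    then have "D - f X < f X + s + \<delta>" using B' by (auto simp: mult_less_cancel_right)
    then show ?thesis using D by simp
  qed
qed

end

theorem theorem2:
  fixes c f :: "'a::bounded_lattice_bot \<Rightarrow> real"
    and B \<delta> :: real
    and Xopt Z :: 'a
  assumes height: "\<And>X::'a. finite_height X"
    and c_nonneg: "\<And>X. 0 \<le> c X"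
    and c_modular: "modular_fun c"
    and c_consistent: "order_consistent c"
    and c_increment: "\<And>a. a \<in> adm bot \<Longrightarrow> c bot \<le> c a"
    and c_fits: "\<And>a. a \<in> adm bot \<Longrightarrow> c a \<le> B"
    and B_nonneg: "0 \<le> B"
    and f_mono: "mono f"
    and f_bot: "f bot = 0"
    and f_DR: "downward_DR_submodular f \<delta>"
    and optimal: "is_arg_max f (\<lambda>X. X \<in> {X. c X \<le> B}) Xopt"
    and returned: "knapsack_greedy_returns f c B Z"
  shows "f Z \<ge> (1 - exp (-1)) / 2 * f Xopt - \<delta> * real (height Xopt) * ((1 - exp (-1)) / 2)"
proof -
  have Xopt_fits: "c Xopt \<le> B" using optimal by (simp add: is_arg_max_def)
  interpret greedy_knapsack c f B \<delta> Xopt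
    using height c_modular c_consistent c_increment f_mono f_bot f_DR Xopt_fits
    by unfold_locales
  let ?G = "f Xopt - \<delta> * real (height Xopt)"
  obtain X where X: "greedy_result f c B X"
    and Z: "{a \<in> adm bot. c a \<le> B} = {} \<and> Z = X \<or>
      (\<exists>a. is_arg_max f (\<lambda>a. a \<in> adm bot \<and> c a \<le> B) a \<and>
           (Z = X \<and> f a \<le> f X \<or> Z = a \<and> f X \<le> f a))"
    using returned unfolding knapsack_greedy_returns_def by blast
  have XZ: "f X \<le> f Z" using Z by auto
  have G: "?G \<le> 3 * f Z"
  \<comment> \<open>Outside this case there is an overshooting step and \<open>height Xopt\<close>
    is positive. Within it, \<open>f Xopt\<close> is already reached, and only the sign of the
    \<delta> term remains.\<close>
  proof (cases "Xopt = bot \<or> adm X = {}")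
    case True
    then have "Xopt \<le> X"
    proof
      assume "adm X = {}"
      then show ?thesis using admissible_below[OF height[of Xopt], of X] by auto
    qed simp
    then have "f Xopt \<le> f Z" using monoD[OF f_mono] XZ by (meson order_trans)
    moreover have "0 \<le> \<delta> * real (height Xopt)"
    proof (cases "Xopt = bot")
      case True
      then show ?thesis by (simp add: height_bot)
    next
      case False
      then obtain b where "b \<in> adm (bot::'a)"
        using admissible_below[OF height, of Xopt bot] by (auto simp: bot_unique)
      then show ?thesis using DR_gap_nonneg[OF height f_DR, of b bot] by simp
    qed
    ultimately show ?thesis using f_nonneg[of Z] by linarith
  next
    case False
    then obtain a where a: "greedy_choice f c X a" "\<not> c (sup X a) \<le> B"
      and reach: "greedy_reachable f c B X"
      using X unfolding greedy_result_def by blast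
    \<comment> \<open>By \<open>c_fits\<close> the second candidate is a maximum over all of
      \<open>adm bot\<close>, so \<open>f Z\<close> can serve as \<open>s\<close>.\<close>
    have "f b \<le> f Z" if b: "b \<in> adm bot" for b
    proof -
      obtain a where a: "is_arg_max f (\<lambda>a. a \<in> adm bot \<and> c a \<le> B) a" and "f a \<le> f Z"
        using Z b c_fits[OF b] by auto
      moreover have "f b \<le> f a"
        using a b c_fits[OF b] unfolding is_arg_max_def by (meson not_less)
      ultimately show ?thesis by simp
    qed
    then show ?thesis
      using greedy_overshoot_bound[OF reach a _ height_pos[OF height], of "f Z"] False XZ
        f_nonneg[of Z] by fastforce
  qed
  define \<kappa> :: real where "\<kappa> = (1 - exp (-1)) / 2"
  \<comment> \<open>The upper bound amounts to \<open>exp 1 \<le> 3\<close>. As \<open>?G\<close>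
    may be negative, the inequality is first scaled by \<kappa>, and \<kappa> is replaced by
    \<open>1 / 3\<close> only next to the nonnegative \<open>f Z\<close>.\<close>
  have \<kappa>: "0 \<le> \<kappa>" "\<kappa> \<le> 1 / 3"
    using exp_le by (simp_all add: \<kappa>_def exp_minus field_simps)
  have "\<kappa> * ?G \<le> \<kappa> * (3 * f Z)" using G \<kappa>(1) by (rule mult_left_mono)
  also have "\<dots> \<le> 1 / 3 * (3 * f Z)"
    using \<kappa>(2) f_nonneg[of Z] by (intro mult_right_mono) simp_all
  finally have "\<kappa> * f Xopt - \<delta> * real (height Xopt) * \<kappa> \<le> f Z" by (simp add: algebra_simps)
  then show ?thesis by (simp only: \<kappa>_def)
qed

end
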